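(* Let $\mathfrak{A},\mathfrak{B}$ be separable unital $C^*$-algebras, let $K\subset\mathfrak{A}$ and $L\subset\mathfrak{B}$ be compact sets generating $\mathfrak{A}$ and $\mathfrak{B}$ respectively, and let $\alpha:\mathfrak{A}\to\mathfrak{B}$ be a unital $*$-homomorphism. Then $\alpha$ is uniformly continuous in the following sense: there exists $\omega\in\Omega$ such that $\omega^L_{\alpha(a)}\le\omega^K_a\circ\omega$ (pointwise on $[0,\infty)$) for every $a\in\mathfrak{A}$.
   Context: A set $K\subset\mathfrak{A}$ generates the unital $C^*$-algebra $\mathfrak{A}$ if the smallest $C^*$-subalgebra of $\mathfrak{A}$ containing $K\cup\{1\}$ is $\mathfrak{A}$. $\operatorname{Rep}(\mathfrak{A})$ denotes the set of all unital $*$-representations $\pi:\mathfrak{A}\to B(\ell^2)$, with the metric $d_K(\pi,\pi')=\sup_{x\in K}\|\pi(x)-\pi'(x)\|$. $\Omega$ is the set of all continuous, concave, nondecreasing functions $\omega:[0,\infty)\to[0,\infty)$ with $\omega(0)=0$ (concavity in the weak sense). For $a\in\mathfrak{A}$ and $t\ge 0$ put $f^K_a(t)=\sup\{\|\pi(a)-\pi'(a)\|:\pi,\pi'\in\operatorname{Rep}(\mathfrak{A}),\ d_K(\pi,\pi')\le t\}$ and $\omega^K_a(t)=\inf\{\omega(t):\omega\in\Omega,\ \omega\ge f^K_a\}$; the set over which the infimum is taken is nonempty. The function $\omega^L_b$ for $b\in\mathfrak{B}$ is defined in the same way from $\operatorname{Rep}(\mathfrak{B})$ and $d_L$. *)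

theory Defs
  imports "HOL-Analysis.Analysis"
begin

section \<open>Unital C*-algebras\<close>

class complex_normed_vector = real_normed_vector +
  fixes scaleC :: "complex \<Rightarrow> 'a \<Rightarrow> 'a"  (infixr \<open>*\<^sub>C\<close> 75)
  assumes scaleC_add_right: "c *\<^sub>C (x + y) = c *\<^sub>C x + c *\<^sub>C y"
    and scaleC_add_left: "(c + d) *\<^sub>C x = c *\<^sub>C x + d *\<^sub>C x"
    and scaleC_scaleC: "c *\<^sub>C d *\<^sub>C x = (c * d) *\<^sub>C x"
    and scaleC_of_real: "complex_of_real r *\<^sub>C x = r *\<^sub>R x"
    and norm_scaleC: "norm (c *\<^sub>C x) = cmod c * norm x"

text \<open>The unit is required by \<^class>\<open>monoid_mult\<close> rather than by \<^class>\<open>real_normed_algebra_1\<close>,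
  so that the zero algebra is included.\<close>

class unital_cstar_algebra =
  complex_normed_vector + real_normed_algebra + banach + monoid_mult +
  fixes cstar :: "'a \<Rightarrow> 'a"
  assumes scaleC_mult_left: "(c *\<^sub>C x) * y = c *\<^sub>C (x * y)"
    and scaleC_mult_right: "x * (c *\<^sub>C y) = c *\<^sub>C (x * y)"
    and cstar_add: "cstar (x + y) = cstar x + cstar y"
    and cstar_scaleC: "cstar (c *\<^sub>C x) = cnj c *\<^sub>C cstar x"
    and cstar_mult: "cstar (x * y) = cstar y * cstar x"
    and cstar_cstar: "cstar (cstar x) = x"
    and cstar_identity: "norm (cstar x * x) = (norm x)\<^sup>2"

definition cstar_subalgebra :: "'a::unital_cstar_algebra set \<Rightarrow> bool" where
  "cstar_subalgebra S \<longleftrightarrow>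
     closed S \<and> 0 \<in> S \<and>
     (\<forall>x\<in>S. \<forall>y\<in>S. x + y \<in> S \<and> x * y \<in> S) \<and>
     (\<forall>x\<in>S. \<forall>c. c *\<^sub>C x \<in> S) \<and>
     (\<forall>x\<in>S. cstar x \<in> S)"

definition generates :: "'a::unital_cstar_algebra set \<Rightarrow> bool" where
  "generates K \<longleftrightarrow> cstar_subalgebra hull (K \<union> {1}) = UNIV"

definition unital_star_hom :: "('a::unital_cstar_algebra \<Rightarrow> 'b::unital_cstar_algebra) \<Rightarrow> bool" where
  "unital_star_hom h \<longleftrightarrow>
     (\<forall>x y. h (x + y) = h x + h y) \<and>
     (\<forall>c x. h (c *\<^sub>C x) = c *\<^sub>C h x) \<and>
     (\<forall>x y. h (x * y) = h x * h y) \<and>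
     (\<forall>x. h (cstar x) = cstar (h x)) \<and>
     h 1 = 1"


section \<open>The complex Hilbert space of square-summable sequences\<close>

typedef ell2 = "{x :: nat \<Rightarrow> complex. summable (\<lambda>n. (cmod (x n))\<^sup>2)}"
  by (rule exI[of _ "\<lambda>_. 0"]) simp

setup_lifting type_definition_ell2

lemma summable_cmod_square_add:
  assumes "summable (\<lambda>n. (cmod (x n))\<^sup>2)" "summable (\<lambda>n. (cmod (y n))\<^sup>2)"
  shows "summable (\<lambda>n. (cmod (x n + y n))\<^sup>2)"
proof (rule summable_comparison_test')
  show "summable (\<lambda>n. 2 * (cmod (x n))\<^sup>2 + 2 * (cmod (y n))\<^sup>2)"
    using assms by (intro summable_add summable_mult)
  fix n
  have "(cmod (x n + y n))\<^sup>2 \<le> (cmod (x n) + cmod (y n))\<^sup>2"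
    by (simp add: norm_triangle_ineq power_mono)
  also have "\<dots> \<le> 2 * (cmod (x n))\<^sup>2 + 2 * (cmod (y n))\<^sup>2"
    using sum_squares_bound[of "cmod (x n)" "cmod (y n)"] by (simp add: power2_sum)
  finally show "norm ((cmod (x n + y n))\<^sup>2) \<le> 2 * (cmod (x n))\<^sup>2 + 2 * (cmod (y n))\<^sup>2"
    by simp
qed

lemma summable_cmod_square_mult:
  assumes "summable (\<lambda>n. (cmod (x n))\<^sup>2)"
  shows "summable (\<lambda>n. (cmod (c * x n))\<^sup>2)"
  using summable_mult[OF assms, of "(cmod c)\<^sup>2"] by (simp add: norm_mult power_mult_distrib)

lemma summable_mult_cnj:
  assumes "summable (\<lambda>n. (cmod (x n))\<^sup>2)" "summable (\<lambda>n. (cmod (y n))\<^sup>2)"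
  shows "summable (\<lambda>n. x n * cnj (y n))"
proof (rule summable_comparison_test')
  show "summable (\<lambda>n. (cmod (x n))\<^sup>2 + (cmod (y n))\<^sup>2)"
    using assms by (rule summable_add)
  fix n
  have "2 * (cmod (x n) * cmod (y n)) \<le> (cmod (x n))\<^sup>2 + (cmod (y n))\<^sup>2"
    using sum_squares_bound[of "cmod (x n)" "cmod (y n)"] by simp
  moreover have "0 \<le> cmod (x n) * cmod (y n)" by simp
  ultimately show "norm (x n * cnj (y n)) \<le> (cmod (x n))\<^sup>2 + (cmod (y n))\<^sup>2"
    unfolding norm_mult complex_mod_cnj by linarith
qed

lift_definition cinner :: "ell2 \<Rightarrow> ell2 \<Rightarrow> complex" is
  "\<lambda>x y. \<Sum>n. x n * cnj (y n)" .

lemma summable_ell2: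
  "summable (\<lambda>n. Rep_ell2 x n * cnj (Rep_ell2 y n))"
  using Rep_ell2[of x] Rep_ell2[of y] by (auto intro: summable_mult_cnj)

lemma summable_ell2_norm: "summable (\<lambda>n. (cmod (Rep_ell2 x n))\<^sup>2)"
  using Rep_ell2[of x] by simp

instantiation ell2 :: complex_normed_vector
begin

lift_definition zero_ell2 :: ell2 is "\<lambda>_. 0" by simp
lift_definition plus_ell2 :: "ell2 \<Rightarrow> ell2 \<Rightarrow> ell2" is "\<lambda>x y n. x n + y n"
  by (rule summable_cmod_square_add)
lift_definition uminus_ell2 :: "ell2 \<Rightarrow> ell2" is "\<lambda>x n. - x n" by simp
lift_definition minus_ell2 :: "ell2 \<Rightarrow> ell2 \<Rightarrow> ell2" is "\<lambda>x y n. x n - y n"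
  subgoal for x y using summable_cmod_square_add[of x "\<lambda>n. - y n"] by simp
  done
lift_definition scaleC_ell2 :: "complex \<Rightarrow> ell2 \<Rightarrow> ell2" is "\<lambda>c x n. c * x n"
  by (rule summable_cmod_square_mult)
lift_definition norm_ell2 :: "ell2 \<Rightarrow> real" is "\<lambda>x. sqrt (\<Sum>n. (cmod (x n))\<^sup>2)" .

definition scaleR_ell2 :: "real \<Rightarrow> ell2 \<Rightarrow> ell2" where
  "scaleR_ell2 r x = complex_of_real r *\<^sub>C x"
definition sgn_ell2 :: "ell2 \<Rightarrow> ell2" where
  "sgn_ell2 x = inverse (norm x) *\<^sub>R x"
definition dist_ell2 :: "ell2 \<Rightarrow> ell2 \<Rightarrow> real" where
  "dist_ell2 x y = norm (x - y)"
definition uniformity_ell2 :: "(ell2 \<times> ell2) filter" where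
  "uniformity_ell2 = (INF e\<in>{0<..}. principal {(x, y). dist x y < e})"
definition open_ell2 :: "ell2 set \<Rightarrow> bool" where
  "open_ell2 U \<longleftrightarrow> (\<forall>x\<in>U. \<forall>\<^sub>F (x', y) in uniformity. x' = x \<longrightarrow> y \<in> U)"

lemma norm_ell2_L2_set:
  "(\<lambda>N. L2_set (\<lambda>n. cmod (Rep_ell2 x n)) {..<N}) \<longlonglongrightarrow> norm x"
  unfolding norm_ell2.rep_eq L2_set_def
  by (intro tendsto_real_sqrt summable_LIMSEQ summable_ell2_norm)

instance
proof
  fix x y z :: ell2 and a b :: real and c d :: complex
  show "x + y + z = x + (y + z)" by transfer (simp add: add.assoc)
  show "x + y = y + x" by transfer (simp add: add.commute)
  show "0 + x = x" by transfer simp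
  show "- x + x = 0" by transfer simp
  show "x - y = x + - y" by transfer simp
  show C1: "c *\<^sub>C (x + y) = c *\<^sub>C x + c *\<^sub>C y" for c and x y :: ell2
    by transfer (simp add: distrib_left)
  show C2: "(c + d) *\<^sub>C x = c *\<^sub>C x + d *\<^sub>C x" for c d and x :: ell2
    by transfer (simp add: distrib_right)
  show C3: "c *\<^sub>C d *\<^sub>C x = (c * d) *\<^sub>C x" for c d and x :: ell2
    by transfer (simp add: mult.assoc)
  have C4: "(1::complex) *\<^sub>C x = x" by transfer simp
  show "complex_of_real a *\<^sub>C x = a *\<^sub>R x" by (simp add: scaleR_ell2_def)
  show "a *\<^sub>R (x + y) = a *\<^sub>R x + a *\<^sub>R y" by (simp add: scaleR_ell2_def C1)
  show "(a + b) *\<^sub>R x = a *\<^sub>R x + b *\<^sub>R x" by (simp add: scaleR_ell2_def C2)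
  show "a *\<^sub>R b *\<^sub>R x = (a * b) *\<^sub>R x" by (simp add: scaleR_ell2_def C3)
  show "1 *\<^sub>R x = x" by (simp add: scaleR_ell2_def C4)
  show "sgn x = inverse (norm x) *\<^sub>R x" by (rule sgn_ell2_def)
  show "dist x y = norm (x - y)" by (rule dist_ell2_def)
  show "uniformity = (INF e\<in>{0<..}. principal {(x, y). dist (x::ell2) y < e})"
    by (rule uniformity_ell2_def)
  show "open U \<longleftrightarrow> (\<forall>x\<in>U. \<forall>\<^sub>F (x', y) in uniformity. x' = x \<longrightarrow> y \<in> U)" for U :: "ell2 set"
    by (rule open_ell2_def)
  show N: "norm (c *\<^sub>C x) = cmod c * norm x" for c and x :: ell2
  proof transfer
    fix c and x :: "nat \<Rightarrow> complex"
    assume "summable (\<lambda>n. (cmod (x n))\<^sup>2)"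
    then have "(\<Sum>n. (cmod (c * x n))\<^sup>2) = (cmod c)\<^sup>2 * (\<Sum>n. (cmod (x n))\<^sup>2)"
      by (simp add: norm_mult power_mult_distrib suminf_mult)
    then show "sqrt (\<Sum>n. (cmod (c * x n))\<^sup>2) = cmod c * sqrt (\<Sum>n. (cmod (x n))\<^sup>2)"
      by (simp add: real_sqrt_mult)
  qed
  show "norm (a *\<^sub>R x) = \<bar>a\<bar> * norm x" by (simp add: scaleR_ell2_def N)
  show "norm x = 0 \<longleftrightarrow> x = 0"
    by transfer (auto simp: suminf_eq_zero_iff)
  show "norm (x + y) \<le> norm x + norm y"
  proof (rule LIMSEQ_le[OF norm_ell2_L2_set])
    show "(\<lambda>N. L2_set (\<lambda>n. cmod (Rep_ell2 x n)) {..<N} + L2_set (\<lambda>n. cmod (Rep_ell2 y n)) {..<N})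
          \<longlonglongrightarrow> norm x + norm y"
      by (intro tendsto_add norm_ell2_L2_set)
    show "\<exists>M. \<forall>N\<ge>M. L2_set (\<lambda>n. cmod (Rep_ell2 (x + y) n)) {..<N}
      \<le> L2_set (\<lambda>n. cmod (Rep_ell2 x n)) {..<N} + L2_set (\<lambda>n. cmod (Rep_ell2 y n)) {..<N}"
      by (intro exI[of _ 0] allI impI order_trans[OF L2_set_mono L2_set_triangle_ineq])
         (auto simp: plus_ell2.rep_eq norm_triangle_ineq)
  qed
qed

end

lemma cinner_norm: "cinner x x = complex_of_real ((norm x)\<^sup>2)"
proof -
  have "cinner x x = (\<Sum>n. complex_of_real ((cmod (Rep_ell2 x n))\<^sup>2))"
    by (simp add: cinner.rep_eq complex_norm_square del: of_real_power)
  then show ?thesis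
    by (simp add: suminf_of_real[OF summable_ell2_norm] norm_ell2.rep_eq
        suminf_nonneg[OF summable_ell2_norm] del: of_real_power)
qed


section \<open>Representations on the sequence space\<close>

text \<open>Elements of \<^typ>\<open>ell2 \<Rightarrow>\<^sub>L ell2\<close> are bounded and real-linear; \<open>bounded_operators\<close> is the
  algebra \<open>B(ell2)\<close> of complex-linear ones. Its norm is the operator norm of
  \<^typ>\<open>ell2 \<Rightarrow>\<^sub>L ell2\<close>.\<close>

definition bounded_operators :: "(ell2 \<Rightarrow>\<^sub>L ell2) set" where
  "bounded_operators = {T. \<forall>c u. blinfun_apply T (c *\<^sub>C u) = c *\<^sub>C blinfun_apply T u}"

definition is_adjoint :: "(ell2 \<Rightarrow>\<^sub>L ell2) \<Rightarrow> (ell2 \<Rightarrow>\<^sub>L ell2) \<Rightarrow> bool" where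
  "is_adjoint S T \<longleftrightarrow> (\<forall>u v. cinner (blinfun_apply S u) v = cinner u (blinfun_apply T v))"

definition Rep :: "('a::unital_cstar_algebra \<Rightarrow> (ell2 \<Rightarrow>\<^sub>L ell2)) set" where
  "Rep = {\<pi>.
     (\<forall>x. \<pi> x \<in> bounded_operators) \<and>
     (\<forall>x y. \<pi> (x + y) = \<pi> x + \<pi> y) \<and>
     (\<forall>c x u. blinfun_apply (\<pi> (c *\<^sub>C x)) u = c *\<^sub>C blinfun_apply (\<pi> x) u) \<and>
     (\<forall>x y. \<pi> (x * y) = \<pi> x o\<^sub>L \<pi> y) \<and>
     (\<forall>x. is_adjoint (\<pi> x) (\<pi> (cstar x))) \<and>
     \<pi> 1 = id_blinfun}"

text \<open>The suprema are taken in \<^typ>\<open>ennreal\<close>, where they always exist and where the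
  supremum of the empty set is \<open>0\<close> (which occurs for empty \<open>K\<close> and for empty \<open>Rep\<close>).\<close>

definition rep_dist ::
  "'a set \<Rightarrow> ('a::unital_cstar_algebra \<Rightarrow> (ell2 \<Rightarrow>\<^sub>L ell2)) \<Rightarrow> ('a \<Rightarrow> (ell2 \<Rightarrow>\<^sub>L ell2)) \<Rightarrow> ennreal" where
  "rep_dist K \<pi> \<pi>' = (SUP x\<in>K. ennreal (norm (\<pi> x - \<pi>' x)))"

definition oscillation :: "'a::unital_cstar_algebra set \<Rightarrow> 'a \<Rightarrow> real \<Rightarrow> ennreal" where
  "oscillation K a t =
     Sup {ennreal (norm (\<pi> a - \<pi>' a)) | \<pi> \<pi>'. \<pi> \<in> Rep \<and> \<pi>' \<in> Rep \<and> rep_dist K \<pi> \<pi>' \<le> ennreal t}"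


section \<open>Moduli of continuity\<close>

text \<open>Functions on \<open>[0,\<infinity>)\<close> are functions on \<^typ>\<open>real\<close> of which only the values
  at nonnegative arguments matter.\<close>

definition Omega :: "(real \<Rightarrow> real) set" where
  "Omega = {\<omega>. continuous_on {0..} \<omega> \<and> concave_on {0..} \<omega> \<and> mono_on {0..} \<omega> \<and>
     (\<forall>t\<ge>0. 0 \<le> \<omega> t) \<and> \<omega> 0 = 0}"

definition modulus :: "'a::unital_cstar_algebra set \<Rightarrow> 'a \<Rightarrow> real \<Rightarrow> real" where
  "modulus K a t = Inf {\<omega> t | \<omega>. \<omega> \<in> Omega \<and> (\<forall>s\<ge>0. oscillation K a s \<le> ennreal (\<omega> s))}"

end

theory Submission
  imports Defs
begin

text \<open>
  Composition with \<open>\<alpha>\<close> turns a representation \<open>\<pi>\<close> of the target algebra into a representation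
  \<open>\<pi> \<circ> \<alpha>\<close> of the source algebra. The function \<open>\<omega>\<close> of the theorem is a modulus of continuity of
  this map, for the metrics \<open>d\<^sub>L\<close> and \<open>d\<^sub>K\<close>. If \<open>d\<^sub>L(\<pi>, \<pi>') \<le> t\<close>, then
  \<open>d\<^sub>K(\<pi> \<circ> \<alpha>, \<pi>' \<circ> \<alpha>) \<le> \<omega>(t)\<close>, hence the oscillation of \<open>\<alpha> a\<close> at \<open>t\<close> is at most the oscillation
  of \<open>a\<close> at \<open>\<omega>(t)\<close>; and since \<open>\<Omega>\<close> is closed under composition, every majorant \<open>\<omega>'\<close> of the
  oscillation of \<open>a\<close> yields the majorant \<open>\<omega>' \<circ> \<omega>\<close> of the oscillation of \<open>\<alpha> a\<close>. Taking the infimum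
  over \<open>\<omega>'\<close> gives the claim.

  Such an \<open>\<omega>\<close> exists because a bounded quantity that tends to \<open>0\<close> with \<open>t\<close> lies below some member
  of \<open>\<Omega>\<close> (\<open>Omega_majorant\<close>). Boundedness comes from contractivity of representations
  (\<open>Rep_contractive\<close>). For convergence to \<open>0\<close>, the elements whose oscillation tends to \<open>0\<close>
  form a C*-subalgebra that contains the generating set (\<open>oscillation_small\<close>), and
  compactness of \<open>K\<close> with contractivity of the \<open>\<pi> \<circ> \<alpha>\<close> makes the convergence uniform over \<open>\<alpha> ` K\<close>
  (\<open>pullback_small\<close>).
\<close>

section \<open>Concave moduli of continuity\<close>

text \<open>A set of pairs \<open>(s, r)\<close> stands for the graph of a multivalued function. For every \<open>\<epsilon>\<close> with
  its \<open>\<delta>\<close>, the line \<open>\<epsilon> + M / \<delta> * s\<close> lies above that graph: up to \<open>\<delta>\<close> because of the constant term,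
  beyond \<open>\<delta>\<close> because of the slope. The infimum of all these lines is concave and vanishes at \<open>0\<close>.\<close>

lemma Omega_majorant:
  fixes D :: "(real \<times> real) set" and M :: real
  assumes nonneg: "\<And>s r. (s, r) \<in> D \<Longrightarrow> 0 \<le> s"
    and bound: "\<And>s r. (s, r) \<in> D \<Longrightarrow> r \<le> M"
    and small: "\<And>\<epsilon>. \<epsilon> > 0 \<Longrightarrow> \<exists>\<delta>>0. \<forall>(s, r)\<in>D. s \<le> \<delta> \<longrightarrow> r \<le> \<epsilon>"
    and M: "0 \<le> M"
  obtains \<omega> where "\<omega> \<in> Omega" "\<And>s r. (s, r) \<in> D \<Longrightarrow> r \<le> \<omega> s"
proof -
  obtain \<delta> where \<delta>: "\<And>\<epsilon>. \<epsilon> > 0 \<Longrightarrow> \<delta> \<epsilon> > 0 \<and> (\<forall>(s, r)\<in>D. s \<le> \<delta> \<epsilon> \<longrightarrow> r \<le> \<epsilon>)"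
    using small by metis
  define line where "line \<epsilon> s = \<epsilon> + M / \<delta> \<epsilon> * s" for \<epsilon> s
  define \<omega> where "\<omega> s = (INF \<epsilon>\<in>{0<..}. line \<epsilon> s)" for s
  have slope: "0 \<le> M / \<delta> \<epsilon>" if "\<epsilon> > 0" for \<epsilon>
    using \<delta>[OF that] M by simp
  have line_nonneg: "0 \<le> line \<epsilon> s" if "\<epsilon> > 0" "0 \<le> s" for \<epsilon> s
    unfolding line_def using slope that by (intro add_nonneg_nonneg mult_nonneg_nonneg) auto
  have lower: "\<omega> s \<le> line \<epsilon> s" if "\<epsilon> > 0" "0 \<le> s" for \<epsilon> s
    unfolding \<omega>_def using that line_nonneg
    by (intro cINF_lower bdd_belowI2[where m = 0]) auto
  have greatest: "c \<le> \<omega> s" if "\<And>\<epsilon>. \<epsilon> > 0 \<Longrightarrow> c \<le> line \<epsilon> s" for c s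
    unfolding \<omega>_def using that by (intro cINF_greatest) (auto intro: exI[of _ 1])
  have \<omega>_nonneg: "0 \<le> \<omega> s" if "0 \<le> s" for s
    using greatest line_nonneg that by blast
  have \<omega>_zero: "\<omega> 0 = 0"
  proof (rule antisym)
    show "\<omega> 0 \<le> 0"
      by (rule field_le_epsilon) (use lower[of _ 0] in \<open>simp add: line_def\<close>)
  qed (simp add: \<omega>_nonneg)
  have \<omega>_mono: "mono_on {0..} \<omega>"
  proof (rule mono_onI)
    fix r s :: real
    assume rs: "r \<in> {0..}" "s \<in> {0..}" "r \<le> s"
    show "\<omega> r \<le> \<omega> s"
    proof (rule greatest)
      fix \<epsilon> :: real
      assume e: "\<epsilon> > 0"
      have "\<omega> r \<le> line \<epsilon> r" using lower e rs by simp
      also have "\<dots> \<le> line \<epsilon> s"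
        unfolding line_def using mult_left_mono[OF rs(3) slope[OF e]] by simp
      finally show "\<omega> r \<le> line \<epsilon> s" .
    qed
  qed
  have \<omega>_concave: "concave_on {0..} \<omega>"
    unfolding concave_on_iff
  proof (intro conjI ballI allI impI)
    fix x y u v :: real
    assume *: "x \<in> {0..}" "y \<in> {0..}" "0 \<le> u" "0 \<le> v" "u + v = 1"
    show "u * \<omega> x + v * \<omega> y \<le> \<omega> (u *\<^sub>R x + v *\<^sub>R y)"
    proof (rule greatest)
      fix \<epsilon> :: real
      assume e: "\<epsilon> > 0"
      have "u * \<omega> x + v * \<omega> y \<le> u * line \<epsilon> x + v * line \<epsilon> y"
        using * e by (intro add_mono mult_left_mono lower) auto
      also have "\<dots> = (u + v) * \<epsilon> + M / \<delta> \<epsilon> * (u *\<^sub>R x + v *\<^sub>R y)"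
        unfolding line_def real_scaleR_def by (simp add: distrib_left distrib_right mult.left_commute)
      also have "\<dots> = line \<epsilon> (u *\<^sub>R x + v *\<^sub>R y)"
        using * by (simp add: line_def)
      finally show "u * \<omega> x + v * \<omega> y \<le> line \<epsilon> (u *\<^sub>R x + v *\<^sub>R y)" .
    qed
  qed simp
  have \<omega>_cont: "continuous_on {0..} \<omega>"
    unfolding continuous_on_eq_continuous_within
  proof
    fix x :: real
    assume "x \<in> {0..}"
    then consider "x > 0" | "x = 0" by fastforce
    then show "continuous (at x within {0..}) \<omega>"
    proof cases
      case 1
      have "convex_on {0<..} (\<lambda>s. - \<omega> s)"
        using \<omega>_concave unfolding concave_on_def by (rule convex_on_subset) auto
      then have "continuous_on {0<..} (\<lambda>s. - (- \<omega> s))"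
        by (intro continuous_on_minus convex_on_continuous) auto
      then have "isCont \<omega> x"
        using 1 by (simp add: continuous_on_eq_continuous_at)
      then show ?thesis by (rule continuous_at_imp_continuous_at_within)
    next
      case 2
      have "(\<omega> \<longlongrightarrow> 0) (at 0 within {0..})"
      proof (rule tendstoI)
        fix e :: real
        assume e: "e > 0"
        have "((\<lambda>s. line (e / 2) s) \<longlongrightarrow> line (e / 2) 0) (at 0 within {0..})"
          unfolding line_def by (intro tendsto_intros)
        moreover have "line (e / 2) 0 < e" using e by (simp add: line_def)
        ultimately have "\<forall>\<^sub>F s in at 0 within {0..}. line (e / 2) s < e"
          by (rule order_tendstoD)
        moreover have "\<forall>\<^sub>F s in at (0::real) within {0..}. s \<in> {0..}"
          by (auto simp: eventually_at_filter)
        ultimately show "\<forall>\<^sub>F s in at 0 within {0..}. dist (\<omega> s) 0 < e"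
        proof eventually_elim
          case (elim s)
          then show ?case using lower[of "e / 2" s] \<omega>_nonneg[of s] e by simp
        qed
      qed
      then show ?thesis using 2 by (simp add: continuous_within \<omega>_zero)
    qed
  qed
  have "r \<le> \<omega> s" if "(s, r) \<in> D" for s r
  proof (rule greatest)
    fix \<epsilon> :: real
    assume e: "\<epsilon> > 0"
    show "r \<le> line \<epsilon> s"
    proof (cases "s \<le> \<delta> \<epsilon>")
      case True
      then have "r \<le> \<epsilon>" using \<delta>[OF e] that by auto
      then show ?thesis
        unfolding line_def using mult_nonneg_nonneg[OF slope[OF e] nonneg[OF that]] by linarith
    next
      case False
      have "r \<le> M / \<delta> \<epsilon> * \<delta> \<epsilon>" using bound[OF that] \<delta>[OF e] by simp
      also have "\<dots> \<le> M / \<delta> \<epsilon> * s" using False by (intro mult_left_mono slope e) auto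
      finally show ?thesis using e by (simp add: line_def)
    qed
  qed
  moreover have "\<omega> \<in> Omega"
    using \<omega>_cont \<omega>_concave \<omega>_mono \<omega>_nonneg \<omega>_zero by (simp add: Omega_def)
  ultimately show thesis using that by blast
qed

lemma Omega_comp:
  assumes f: "f \<in> Omega" and g: "g \<in> Omega"
  shows "(\<lambda>t. f (g t)) \<in> Omega"
proof -
  have g0: "g t \<in> {0..}" if "t \<in> {0..}" for t
    using g that by (auto simp: Omega_def)
  have "continuous_on {0..} (\<lambda>t. f (g t))"
    by (rule continuous_on_compose2[of "{0..}" f]) (use f g g0 in \<open>auto simp: Omega_def\<close>)
  moreover have "mono_on {0..} (\<lambda>t. f (g t))"
  proof (rule mono_onI)
    fix r s :: real
    assume rs: "r \<in> {0..}" "s \<in> {0..}" "r \<le> s"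
    have "g r \<le> g s" using g rs by (simp add: Omega_def mono_on_def)
    then show "f (g r) \<le> f (g s)"
      using f g0[OF rs(1)] g0[OF rs(2)] by (simp add: Omega_def mono_on_def)
  qed
  moreover have "concave_on {0..} (\<lambda>t. f (g t))"
    unfolding concave_on_iff
  proof (intro conjI ballI allI impI)
    fix x y u v :: real
    assume *: "x \<in> {0..}" "y \<in> {0..}" "0 \<le> u" "0 \<le> v" "u + v = 1"
    have "u * f (g x) + v * f (g y) \<le> f (u *\<^sub>R g x + v *\<^sub>R g y)"
      using f g0 * by (simp add: Omega_def concave_on_iff)
    also have "\<dots> \<le> f (g (u *\<^sub>R x + v *\<^sub>R y))"
    proof (rule mono_onD[of "{0..}" f])
      show "mono_on {0..} f" using f by (simp add: Omega_def)
      show "u *\<^sub>R g x + v *\<^sub>R g y \<in> {0..}" "g (u *\<^sub>R x + v *\<^sub>R y) \<in> {0..}"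
        using g0[of x] g0[of y] g0[of "u *\<^sub>R x + v *\<^sub>R y"] * by auto
      show "u *\<^sub>R g x + v *\<^sub>R g y \<le> g (u *\<^sub>R x + v *\<^sub>R y)"
        using g * by (simp add: Omega_def concave_on_iff)
    qed
    finally show "u * f (g x) + v * f (g y) \<le> f (g (u *\<^sub>R x + v *\<^sub>R y))" .
  qed simp
  ultimately show ?thesis using f g by (simp add: Omega_def)
qed


section \<open>The real part of the inner product\<close>

lemma Re_cinner: "Re (cinner x y) = (\<Sum>n. Re (Rep_ell2 x n * cnj (Rep_ell2 y n)))"
  unfolding cinner.rep_eq by (rule bounded_linear.suminf[OF bounded_linear_Re summable_ell2])

lemma Re_cinner_commute: "Re (cinner x y) = Re (cinner y x)"
  unfolding Re_cinner by (simp add: mult.commute)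

lemma cinner_add_left: "cinner (x + y) z = cinner x z + cinner y z"
  unfolding cinner.rep_eq plus_ell2.rep_eq distrib_right
  by (rule suminf_add[symmetric, OF summable_ell2 summable_ell2])

lemma Re_cinner_add_right: "Re (cinner x (y + z)) = Re (cinner x y) + Re (cinner x z)"
  using cinner_add_left[of y z x] by (simp add: Re_cinner_commute[of x])

lemma cinner_scaleR_left: "cinner (r *\<^sub>R x) y = r *\<^sub>R cinner x y"
  unfolding cinner.rep_eq scaleR_ell2_def scaleC_ell2.rep_eq
  using suminf_mult[OF summable_ell2[of x y], of "complex_of_real r"]
  by (simp add: mult.assoc scaleR_conv_of_real)

lemma cinner_diff_left: "cinner (x - y) z = cinner x z - cinner y z"
  using cinner_add_left[of "x - y" y z] by simp

lemma cinner_diff_right: "cinner x (y - z) = cinner x y - cinner x z"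
  unfolding cinner.rep_eq minus_ell2.rep_eq complex_cnj_diff right_diff_distrib
  by (rule suminf_diff[symmetric, OF summable_ell2 summable_ell2])

lemma norm_add_square: "(norm (x + y))\<^sup>2 = (norm x)\<^sup>2 + 2 * Re (cinner x y) + (norm y)\<^sup>2"
  for x y :: ell2
proof -
  have "(norm z)\<^sup>2 = Re (cinner z z)" for z :: ell2 by (simp add: cinner_norm)
  then show ?thesis
    by (simp add: cinner_add_left Re_cinner_add_right Re_cinner_commute[of y x])
qed

text \<open>The norm already satisfies the triangle inequality, and expanding its square gives the
  Cauchy-Schwarz inequality.\<close>

lemma Re_cinner_le: "Re (cinner x y) \<le> norm x * norm y"
proof -
  have "(norm (x + y))\<^sup>2 \<le> (norm x + norm y)\<^sup>2"
    by (intro power_mono norm_triangle_ineq norm_ge_zero)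
  then show ?thesis by (simp add: norm_add_square power2_sum)
qed

lemma norm_diff_scaleR_square:
  "(norm (x - r *\<^sub>R y))\<^sup>2 = (norm x)\<^sup>2 - 2 * r * Re (cinner y x) + r\<^sup>2 * (norm y)\<^sup>2" for x y :: ell2
  using norm_add_square[of x "(- r) *\<^sub>R y"]
  by (simp add: Re_cinner_commute[of x] cinner_scaleR_left[of "- r", simplified] power_mult_distrib)

lemma is_adjoint_diff:
  "is_adjoint S T \<Longrightarrow> is_adjoint S' T' \<Longrightarrow> is_adjoint (S - S') (T - T')"
  by (simp add: is_adjoint_def blinfun.diff_left cinner_diff_left cinner_diff_right)

lemma norm_adjoint_le:
  assumes "is_adjoint S T"
  shows "norm T \<le> norm S"
proof (rule norm_blinfun_bound)
  fix v
  have "(norm (T v))\<^sup>2 = Re (cinner (S (T v)) v)"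
    using assms by (simp add: is_adjoint_def cinner_norm)
  also have "\<dots> \<le> norm (S (T v)) * norm v" by (rule Re_cinner_le)
  also have "\<dots> \<le> (norm S * norm (T v)) * norm v"
    by (intro mult_right_mono norm_blinfun norm_ge_zero)
  finally have "norm (T v) * norm (T v) \<le> (norm S * norm v) * norm (T v)"
    by (simp add: power2_eq_square mult_ac)
  then show "norm (T v) \<le> norm S * norm v"
    by (cases "norm (T v) = 0") (auto simp: mult_le_cancel_right)
qed simp


section \<open>Representations are contractive\<close>

text \<open>The class does not fix the norm of the unit, so the geometric series is compared with
  the powers of \<open>norm y\<close> from exponent one on.\<close>

lemma left_inverse_one_minus:
  fixes y :: "'a::unital_cstar_algebra"
  assumes "norm y < 1"
  obtains z where "z * (1 - y) = 1"
proof -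
  have pow: "norm (y ^ Suc n) \<le> norm y ^ Suc n" for n
  proof (induction n)
    case (Suc n)
    have "norm (y ^ Suc (Suc n)) \<le> norm y * norm (y ^ Suc n)"
      by (simp add: norm_mult_ineq)
    also have "\<dots> \<le> norm y * norm y ^ Suc n"
      by (intro mult_left_mono Suc.IH) simp
    finally show ?case by simp
  qed simp
  have "summable (\<lambda>n. norm y ^ Suc n)"
    using assms by (subst summable_Suc_iff) (simp add: summable_geometric)
  then have "summable (\<lambda>n. y ^ Suc n)"
    by (rule summable_comparison_test'[where N = 0]) (rule pow)
  then have s: "summable (\<lambda>n. y ^ n)" by (subst (asm) summable_Suc_iff)
  have "(\<Sum>n. y ^ n) * (1 - y) = (\<Sum>n. y ^ n) - (\<Sum>n. y ^ Suc n)"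
    using suminf_mult2[OF s, of y] by (simp add: right_diff_distrib power_Suc2 del: power_Suc)
  also have "\<dots> = 1" using suminf_split_head[OF s] by simp
  finally show thesis by (rule that)
qed

lemma Rep_add: "\<pi> \<in> Rep \<Longrightarrow> \<pi> (x + y) = \<pi> x + \<pi> y"
  by (simp add: Rep_def)

lemma Rep_diff: "\<pi> \<in> Rep \<Longrightarrow> \<pi> (x - y) = \<pi> x - \<pi> y"
  using Rep_add[of \<pi> "x - y" y] by simp

lemma Rep_zero: "\<pi> \<in> Rep \<Longrightarrow> \<pi> 0 = 0"
  using Rep_diff[of \<pi> 0 0] by simp

lemma Rep_scaleC: "\<pi> \<in> Rep \<Longrightarrow> blinfun_apply (\<pi> (c *\<^sub>C x)) u = c *\<^sub>C blinfun_apply (\<pi> x) u"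
  by (simp add: Rep_def)

lemma Rep_scaleR: "\<pi> \<in> Rep \<Longrightarrow> blinfun_apply (\<pi> (r *\<^sub>R x)) u = r *\<^sub>R blinfun_apply (\<pi> x) u"
  using Rep_scaleC[of \<pi> "complex_of_real r" x u] by (simp add: scaleC_of_real)

lemma Rep_mult: "\<pi> \<in> Rep \<Longrightarrow> \<pi> (x * y) = \<pi> x o\<^sub>L \<pi> y"
  by (simp add: Rep_def)

lemma Rep_one: "\<pi> \<in> Rep \<Longrightarrow> \<pi> 1 = id_blinfun"
  by (simp add: Rep_def)

lemma Rep_cstar: "\<pi> \<in> Rep \<Longrightarrow> is_adjoint (\<pi> x) (\<pi> (cstar x))"
  by (simp add: Rep_def)

text \<open>The positive operator \<open>T = \<pi> (x\<^sup>* x)\<close> has its norm \<open>m = \<parallel>\<pi> x\<parallel>\<^sup>2\<close> as an approximate eigenvalue.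
  If \<open>m\<close> exceeded \<open>\<parallel>x\<^sup>* x\<parallel> = \<parallel>x\<parallel>\<^sup>2\<close>, the geometric series would invert \<open>1 - x\<^sup>* x / m\<close>, so \<open>1 - T / m\<close>
  would be bounded below by some \<open>1 / C\<close>. But
  \<open>\<parallel>u - T u / m\<parallel>\<^sup>2 \<le> \<parallel>u\<parallel>\<^sup>2 - \<parallel>\<pi> x u\<parallel>\<^sup>2 / m\<close>, so \<open>\<parallel>\<pi> x u\<parallel>\<^sup>2 \<le> m (1 - 1 / C\<^sup>2) \<parallel>u\<parallel>\<^sup>2\<close>, and \<open>\<parallel>\<pi> x\<parallel>\<^sup>2\<close>
  would be smaller than \<open>m\<close>.\<close>

lemma Rep_contractive:
  fixes x :: "'a::unital_cstar_algebra"
  assumes \<pi>: "\<pi> \<in> Rep"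
  shows "norm (\<pi> x) \<le> norm x"
proof (rule ccontr)
  assume "\<not> norm (\<pi> x) \<le> norm x"
  then have less: "norm x < norm (\<pi> x)" by simp
  define m where "m = (norm (\<pi> x))\<^sup>2"
  define T where "T = \<pi> (cstar x * x)"
  have npos: "0 < norm (\<pi> x)" by (rule le_less_trans[OF norm_ge_zero less])
  then have m: "0 < m" by (simp add: m_def)
  have "norm ((1 / m) *\<^sub>R (cstar x * x)) = (norm x)\<^sup>2 / m"
    using m by (simp add: cstar_identity)
  also have "\<dots> < 1"
    using less m by (simp add: m_def power_strict_mono)
  finally obtain z where z: "z * (1 - (1 / m) *\<^sub>R (cstar x * x)) = 1"
    by (rule left_inverse_one_minus)
  have inv: "\<pi> z (u - (1 / m) *\<^sub>R T u) = u" for u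
  proof -
    have "\<pi> (z * (1 - (1 / m) *\<^sub>R (cstar x * x))) u = u"
      by (simp add: z Rep_one[OF \<pi>])
    then show ?thesis
      by (simp add: Rep_mult[OF \<pi>, of z] Rep_diff[OF \<pi>] Rep_one[OF \<pi>] Rep_scaleR[OF \<pi>]
          T_def blinfun.diff_left del: scaleR_one)
  qed
  have contr: "(norm (u - (1 / m) *\<^sub>R T u))\<^sup>2 \<le> (norm u)\<^sup>2 - (norm (\<pi> x u))\<^sup>2 / m" for u
  proof -
    have adj: "is_adjoint (\<pi> (cstar x)) (\<pi> x)"
      using Rep_cstar[OF \<pi>, of "cstar x"] by (simp add: cstar_cstar)
    have Tu: "T u = \<pi> (cstar x) (\<pi> x u)" by (simp add: T_def Rep_mult[OF \<pi>])
    then have inner: "Re (cinner (T u) u) = (norm (\<pi> x u))\<^sup>2"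
      using adj by (simp add: is_adjoint_def cinner_norm)
    have "norm (T u) \<le> norm (\<pi> (cstar x)) * norm (\<pi> x u)"
      unfolding Tu by (rule norm_blinfun)
    also have "\<dots> \<le> norm (\<pi> x) * norm (\<pi> x u)"
      by (intro mult_right_mono norm_adjoint_le[OF Rep_cstar[OF \<pi>]]) simp
    finally have "(norm (T u))\<^sup>2 \<le> m * (norm (\<pi> x u))\<^sup>2"
      unfolding m_def power_mult_distrib[symmetric] by (intro power_mono) auto
    then have "(1 / m)\<^sup>2 * (norm (T u))\<^sup>2 \<le> (1 / m)\<^sup>2 * (m * (norm (\<pi> x u))\<^sup>2)"
      by (intro mult_left_mono) auto
    also have "\<dots> = (norm (\<pi> x u))\<^sup>2 / m"
      using m by (simp add: power2_eq_square)
    finally show ?thesis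
      unfolding norm_diff_scaleR_square inner by simp
  qed
  \<comment> \<open>Adding one makes \<open>C \<ge> 1\<close>, so that \<open>1 - 1 / C\<^sup>2\<close> has a square root.\<close>
  define C where "C = norm (\<pi> z) + 1"
  have C: "1 \<le> C" by (simp add: C_def)
  define q where "q = 1 - 1 / C\<^sup>2"
  have q: "0 \<le> q" "q < 1"
    using C by (auto simp: q_def)
  have "norm (\<pi> x u) \<le> sqrt (m * q) * norm u" for u
  proof -
    define w where "w = u - (1 / m) *\<^sub>R T u"
    have "norm u \<le> norm (\<pi> z) * norm w"
      using norm_blinfun[of "\<pi> z" w] unfolding w_def inv .
    also have "\<dots> \<le> C * norm w"
      by (intro mult_right_mono) (auto simp: C_def)
    finally have "(norm u)\<^sup>2 \<le> C\<^sup>2 * (norm w)\<^sup>2"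
      unfolding power_mult_distrib[symmetric] by (intro power_mono) auto
    also have "\<dots> \<le> C\<^sup>2 * ((norm u)\<^sup>2 - (norm (\<pi> x u))\<^sup>2 / m)"
      unfolding w_def by (intro mult_left_mono contr) simp
    finally have "(norm (\<pi> x u))\<^sup>2 \<le> m * q * (norm u)\<^sup>2"
      using m C by (simp add: q_def field_simps)
    then have "sqrt ((norm (\<pi> x u))\<^sup>2) \<le> sqrt (m * q * (norm u)\<^sup>2)"
      by (rule real_sqrt_le_mono)
    then show ?thesis by (simp add: real_sqrt_mult)
  qed
  then have "norm (\<pi> x) \<le> sqrt (m * q)"
    using m q by (intro norm_blinfun_bound) auto
  then have "m \<le> m * q"
    unfolding m_def using q
    by (metis abs_norm_cancel m_def norm_ge_zero real_sqrt_abs real_sqrt_le_iff)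
  then show False using m q by simp
qed

lemma Rep_diff_bound:
  assumes "\<pi> \<in> Rep" "\<pi>' \<in> Rep"
  shows "norm (\<pi> x - \<pi>' x) \<le> 2 * norm x"
  using norm_triangle_ineq4[of "\<pi> x" "\<pi>' x"] Rep_contractive[OF assms(1), of x]
    Rep_contractive[OF assms(2), of x] by linarith

text \<open>Contractivity makes the distance between \<open>\<pi> x\<close> and \<open>\<pi>' x\<close> Lipschitz in \<open>x\<close>, uniformly in
  the two representations.\<close>

lemma Rep_diff_Lipschitz:
  assumes "\<pi> \<in> Rep" "\<pi>' \<in> Rep"
  shows "norm (\<pi> x - \<pi>' x) \<le> norm (\<pi> y - \<pi>' y) + 2 * norm (x - y)"
proof -
  have "\<pi> x - \<pi>' x = (\<pi> y - \<pi>' y) + (\<pi> (x - y) - \<pi>' (x - y))"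
    using assms by (simp add: Rep_diff)
  then show ?thesis
    using norm_triangle_ineq[of "\<pi> y - \<pi>' y" "\<pi> (x - y) - \<pi>' (x - y)"]
      Rep_diff_bound[OF assms, of "x - y"] by simp
qed


section \<open>Oscillations tend to zero\<close>

lemma rep_dist_le_iff:
  "0 \<le> t \<Longrightarrow> rep_dist K \<pi> \<pi>' \<le> ennreal t \<longleftrightarrow> (\<forall>x\<in>K. norm (\<pi> x - \<pi>' x) \<le> t)"
  by (simp add: rep_dist_def SUP_le_iff)

lemma oscillation_le_iff:
  assumes "0 \<le> r" "0 \<le> t"
  shows "oscillation K a t \<le> ennreal r \<longleftrightarrow>
    (\<forall>\<pi>\<in>Rep. \<forall>\<pi>'\<in>Rep. (\<forall>x\<in>K. norm (\<pi> x - \<pi>' x) \<le> t) \<longrightarrow> norm (\<pi> a - \<pi>' a) \<le> r)"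
proof -
  have "oscillation K a t \<le> ennreal r \<longleftrightarrow> (\<forall>\<pi> \<pi>'. \<pi> \<in> Rep \<and> \<pi>' \<in> Rep \<and>
      rep_dist K \<pi> \<pi>' \<le> ennreal t \<longrightarrow> ennreal (norm (\<pi> a - \<pi>' a)) \<le> ennreal r)"
    unfolding oscillation_def Sup_le_iff by blast
  then show ?thesis
    using assms by (simp add: rep_dist_le_iff) blast
qed

text \<open>The elements with this property form a C*-subalgebra: contractivity bounds the factors in
  the product rule and carries the property to limits. That subalgebra contains \<open>K\<close>.\<close>

lemma oscillation_small:
  fixes K :: "'a::unital_cstar_algebra set"
  assumes "generates K" and "\<epsilon> > 0"
  shows "\<exists>\<delta>>0. \<forall>\<pi>\<in>Rep. \<forall>\<pi>'\<in>Rep. (\<forall>x\<in>K. norm (\<pi> x - \<pi>' x) \<le> \<delta>) \<longrightarrow> norm (\<pi> a - \<pi>' a) \<le> \<epsilon>"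
proof -
  define near :: "real \<Rightarrow> ('a \<Rightarrow> ell2 \<Rightarrow>\<^sub>L ell2) \<Rightarrow> ('a \<Rightarrow> ell2 \<Rightarrow>\<^sub>L ell2) \<Rightarrow> bool" where
    "near \<delta> \<pi> \<pi>' \<longleftrightarrow> \<pi> \<in> Rep \<and> \<pi>' \<in> Rep \<and> (\<forall>x\<in>K. norm (\<pi> x - \<pi>' x) \<le> \<delta>)" for \<delta> \<pi> \<pi>'
  define S where
    "S = {a. \<forall>\<epsilon>>0. \<exists>\<delta>>0. \<forall>\<pi> \<pi>'. near \<delta> \<pi> \<pi>' \<longrightarrow> norm (\<pi> a - \<pi>' a) \<le> \<epsilon>}"
  have near_Rep: "\<pi> \<in> Rep" "\<pi>' \<in> Rep" if "near \<delta> \<pi> \<pi>'" for \<delta> \<pi> \<pi>'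
    using that by (simp_all add: near_def)
  have near_min: "near \<delta> \<pi> \<pi>' \<and> near \<delta>' \<pi> \<pi>'" if "near (min \<delta> \<delta>') \<pi> \<pi>'" for \<delta> \<delta>' \<pi> \<pi>'
    using that by (auto simp: near_def)
  \<comment> \<open>An estimate that is linear in the distances for two members of \<open>S\<close> gives membership in \<open>S\<close>.\<close>
  have S_step: "c \<in> S"
    if a: "a \<in> S" and b: "b \<in> S" and M: "0 \<le> M"
      and est: "\<And>\<delta> \<pi> \<pi>'. near \<delta> \<pi> \<pi>' \<Longrightarrow>
        norm (\<pi> c - \<pi>' c) \<le> M * norm (\<pi> a - \<pi>' a) + M * norm (\<pi> b - \<pi>' b)" for a b c M
    unfolding S_def
  proof (intro CollectI allI impI)
    fix \<epsilon> :: real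
    assume e: "\<epsilon> > 0"
    define \<eta> where "\<eta> = \<epsilon> / (2 * M + 1)"
    have \<eta>: "\<eta> > 0" using e M by (simp add: \<eta>_def)
    have "(2 * M + 1) * \<eta> = \<epsilon>" using M by (simp add: \<eta>_def)
    then have \<eta>_le: "M * \<eta> + M * \<eta> \<le> \<epsilon>" using \<eta> by (simp add: distrib_right)
    obtain \<delta> where \<delta>: "\<delta> > 0" "\<And>\<pi> \<pi>'. near \<delta> \<pi> \<pi>' \<Longrightarrow> norm (\<pi> a - \<pi>' a) \<le> \<eta>"
      using a \<eta> unfolding S_def by blast
    obtain \<delta>' where \<delta>': "\<delta>' > 0" "\<And>\<pi> \<pi>'. near \<delta>' \<pi> \<pi>' \<Longrightarrow> norm (\<pi> b - \<pi>' b) \<le> \<eta>"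
      using b \<eta> unfolding S_def by blast
    have "norm (\<pi> c - \<pi>' c) \<le> \<epsilon>" if n: "near (min \<delta> \<delta>') \<pi> \<pi>'" for \<pi> \<pi>'
    proof -
      have "norm (\<pi> c - \<pi>' c) \<le> M * norm (\<pi> a - \<pi>' a) + M * norm (\<pi> b - \<pi>' b)"
        by (rule est[OF n])
      also have "\<dots> \<le> M * \<eta> + M * \<eta>"
        using near_min[OF n] by (intro add_mono mult_left_mono \<delta>(2) \<delta>'(2) M) auto
      finally show ?thesis using \<eta>_le by linarith
    qed
    moreover have "min \<delta> \<delta>' > 0" using \<delta> \<delta>' by simp
    ultimately show "\<exists>\<delta>>0. \<forall>\<pi> \<pi>'. near \<delta> \<pi> \<pi>' \<longrightarrow> norm (\<pi> c - \<pi>' c) \<le> \<epsilon>" by blast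
  qed
  have zero: "0 \<in> S"
  proof -
    have "norm (\<pi> 0 - \<pi>' 0) \<le> \<epsilon>" if "near 1 \<pi> \<pi>'" "\<epsilon> > 0" for \<pi> \<pi>' \<epsilon>
      using near_Rep[OF that(1)] that(2) by (simp add: Rep_zero)
    then show ?thesis unfolding S_def using zero_less_one by blast
  qed
  have one: "1 \<in> S"
  proof -
    have "norm (\<pi> 1 - \<pi>' 1) \<le> \<epsilon>" if "near 1 \<pi> \<pi>'" "\<epsilon> > 0" for \<pi> \<pi>' \<epsilon>
      using near_Rep[OF that(1)] that(2) by (simp add: Rep_one)
    then show ?thesis unfolding S_def using zero_less_one by blast
  qed
  have K: "K \<subseteq> S"
    unfolding S_def near_def by blast
  have add: "a + b \<in> S" if "a \<in> S" "b \<in> S" for a b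
  proof (rule S_step[OF that, of 1])
    fix \<delta> \<pi> \<pi>'
    assume n: "near \<delta> \<pi> \<pi>'"
    have "\<pi> (a + b) - \<pi>' (a + b) = (\<pi> a - \<pi>' a) + (\<pi> b - \<pi>' b)"
      using near_Rep[OF n] by (simp add: Rep_add)
    then show "norm (\<pi> (a + b) - \<pi>' (a + b)) \<le> 1 * norm (\<pi> a - \<pi>' a) + 1 * norm (\<pi> b - \<pi>' b)"
      using norm_triangle_ineq[of "\<pi> a - \<pi>' a" "\<pi> b - \<pi>' b"] by simp
  qed simp
  have mult: "a * b \<in> S" if "a \<in> S" "b \<in> S" for a b
  proof (rule S_step[OF that, of "norm a + norm b"])
    fix \<delta> \<pi> \<pi>'
    assume n: "near \<delta> \<pi> \<pi>'"
    note R = near_Rep[OF n]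
    have "\<pi> (a * b) - \<pi>' (a * b) = (\<pi> a o\<^sub>L (\<pi> b - \<pi>' b)) + ((\<pi> a - \<pi>' a) o\<^sub>L \<pi>' b)"
      using R by (intro blinfun_eqI)
        (simp add: Rep_mult blinfun.diff_left blinfun.diff_right blinfun.add_left)
    also have "norm \<dots> \<le> norm (\<pi> a) * norm (\<pi> b - \<pi>' b) + norm (\<pi> a - \<pi>' a) * norm (\<pi>' b)"
      by (rule norm_triangle_le) (intro add_mono norm_blinfun_compose)
    also have "\<dots> \<le> (norm a + norm b) * norm (\<pi> b - \<pi>' b)
        + norm (\<pi> a - \<pi>' a) * (norm a + norm b)"
      using Rep_contractive[OF R(1), of a] Rep_contractive[OF R(2), of b]
      by (intro add_mono mult_right_mono mult_left_mono) (auto intro: add_increasing add_increasing2)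
    finally show "norm (\<pi> (a * b) - \<pi>' (a * b))
        \<le> (norm a + norm b) * norm (\<pi> a - \<pi>' a) + (norm a + norm b) * norm (\<pi> b - \<pi>' b)"
      by (simp add: algebra_simps)
  qed simp
  have scale: "c *\<^sub>C a \<in> S" if "a \<in> S" for a c
  proof (rule S_step[OF that that, of "cmod c"])
    fix \<delta> \<pi> \<pi>'
    assume n: "near \<delta> \<pi> \<pi>'"
    have "norm (\<pi> (c *\<^sub>C a) - \<pi>' (c *\<^sub>C a)) \<le> cmod c * norm (\<pi> a - \<pi>' a)"
    proof (rule norm_blinfun_bound)
      fix u
      have distr: "c *\<^sub>C v - c *\<^sub>C w = c *\<^sub>C (v - w)" for v w :: ell2
        using scaleC_add_right[of c "v - w" w] by simp
      have "norm ((\<pi> (c *\<^sub>C a) - \<pi>' (c *\<^sub>C a)) u) = cmod c * norm ((\<pi> a - \<pi>' a) u)"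
        using near_Rep[OF n] by (simp add: blinfun.diff_left Rep_scaleC distr norm_scaleC)
      also have "\<dots> \<le> cmod c * (norm (\<pi> a - \<pi>' a) * norm u)"
        by (intro mult_left_mono norm_blinfun) simp
      finally show "norm ((\<pi> (c *\<^sub>C a) - \<pi>' (c *\<^sub>C a)) u) \<le> cmod c * norm (\<pi> a - \<pi>' a) * norm u"
        by (simp add: mult.assoc)
    qed simp
    then show "norm (\<pi> (c *\<^sub>C a) - \<pi>' (c *\<^sub>C a))
        \<le> cmod c * norm (\<pi> a - \<pi>' a) + cmod c * norm (\<pi> a - \<pi>' a)"
      by (rule order_trans) simp
  qed simp
  have star: "cstar a \<in> S" if "a \<in> S" for a
  proof (rule S_step[OF that that, of 1])
    fix \<delta> \<pi> \<pi>'
    assume n: "near \<delta> \<pi> \<pi>'"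
    have "norm (\<pi> (cstar a) - \<pi>' (cstar a)) \<le> norm (\<pi> a - \<pi>' a)"
      using near_Rep[OF n] by (intro norm_adjoint_le is_adjoint_diff Rep_cstar)
    then show "norm (\<pi> (cstar a) - \<pi>' (cstar a))
        \<le> 1 * norm (\<pi> a - \<pi>' a) + 1 * norm (\<pi> a - \<pi>' a)"
      by (rule order_trans) simp
  qed simp
  have "closure S \<subseteq> S"
  proof
    fix a
    assume a: "a \<in> closure S"
    show "a \<in> S"
      unfolding S_def
    proof (intro CollectI allI impI)
      fix \<epsilon> :: real
      assume e: "\<epsilon> > 0"
      then obtain b where b: "b \<in> S" "dist b a < \<epsilon> / 4"
        using a unfolding closure_approachable by (meson zero_less_divide_iff zero_less_numeral)
      obtain \<delta> where \<delta>: "\<delta> > 0" "\<And>\<pi> \<pi>'. near \<delta> \<pi> \<pi>' \<Longrightarrow> norm (\<pi> b - \<pi>' b) \<le> \<epsilon> / 2"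
        using b(1) half_gt_zero[OF e] unfolding S_def by blast
      have "norm (\<pi> a - \<pi>' a) \<le> \<epsilon>" if n: "near \<delta> \<pi> \<pi>'" for \<pi> \<pi>'
        using Rep_diff_Lipschitz[OF near_Rep[OF n], of a b] \<delta>(2)[OF n] b(2)
        by (simp add: dist_norm norm_minus_commute)
      then show "\<exists>\<delta>>0. \<forall>\<pi> \<pi>'. near \<delta> \<pi> \<pi>' \<longrightarrow> norm (\<pi> a - \<pi>' a) \<le> \<epsilon>"
        using \<delta>(1) by blast
    qed
  qed
  then have "closed S" by (simp add: closure_subset_eq)
  then have "cstar_subalgebra S"
    using zero add mult scale star by (simp add: cstar_subalgebra_def)
  then have "cstar_subalgebra hull (K \<union> {1}) \<subseteq> S"
    using K one by (intro hull_minimal) auto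
  then have "a \<in> S" using assms(1) by (auto simp: generates_def)
  then show ?thesis using assms(2) unfolding S_def near_def by fast
qed

lemma oscillation_majorant:
  assumes "generates K"
  obtains \<omega> where "\<omega> \<in> Omega" "\<And>s. 0 \<le> s \<Longrightarrow> oscillation K a s \<le> ennreal (\<omega> s)"
proof -
  define D where "D = {(s, norm (\<pi> a - \<pi>' a)) |s \<pi> \<pi>'. 0 \<le> s \<and> \<pi> \<in> Rep \<and> \<pi>' \<in> Rep \<and>
    (\<forall>x\<in>K. norm (\<pi> x - \<pi>' x) \<le> s)}"
  have "\<exists>\<delta>>0. \<forall>(s, r)\<in>D. s \<le> \<delta> \<longrightarrow> r \<le> \<epsilon>" if \<epsilon>: "\<epsilon> > 0" for \<epsilon>
  proof -
    obtain \<delta> where \<delta>: "\<delta> > 0" "\<And>\<pi> \<pi>'. \<pi> \<in> Rep \<Longrightarrow> \<pi>' \<in> Rep \<Longrightarrow>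
        \<forall>x\<in>K. norm (\<pi> x - \<pi>' x) \<le> \<delta> \<Longrightarrow> norm (\<pi> a - \<pi>' a) \<le> \<epsilon>"
      using oscillation_small[OF assms \<epsilon>, of a] by blast
    then have "\<forall>(s, r)\<in>D. s \<le> \<delta> \<longrightarrow> r \<le> \<epsilon>"
      unfolding D_def by (auto intro!: \<delta>(2) intro: order_trans)
    with \<delta>(1) show ?thesis by blast
  qed
  then obtain \<omega> where \<omega>: "\<omega> \<in> Omega" "\<And>s r. (s, r) \<in> D \<Longrightarrow> r \<le> \<omega> s"
    by (rule Omega_majorant[of D "2 * norm a", rotated 2]) (auto simp: D_def Rep_diff_bound)
  have "oscillation K a s \<le> ennreal (\<omega> s)" if "0 \<le> s" for s
  proof -
    have "0 \<le> \<omega> s" using \<omega>(1) that by (simp add: Omega_def)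
    then show ?thesis using \<omega>(2) that by (auto simp: oscillation_le_iff D_def)
  qed
  with \<omega>(1) show thesis using that by blast
qed


section \<open>Pulling representations back along a homomorphism\<close>

lemma Rep_comp:
  assumes "unital_star_hom \<alpha>" "\<pi> \<in> Rep"
  shows "(\<lambda>x. \<pi> (\<alpha> x)) \<in> Rep"
  using assms by (simp add: Rep_def unital_star_hom_def)

text \<open>On a finite net of \<open>K\<close> the oscillations are small together. The estimate spreads from
  the net to \<open>K\<close> because the representations \<open>\<pi> \<circ> \<alpha>\<close> are contractive on the source algebra.\<close>

lemma pullback_small:
  fixes K :: "'a::unital_cstar_algebra set" and L :: "'b::unital_cstar_algebra set"
  assumes \<alpha>: "unital_star_hom \<alpha>" and K: "compact K" and L: "generates L" and e: "\<epsilon> > 0"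
  shows "\<exists>\<delta>>0. \<forall>\<pi>\<in>Rep. \<forall>\<pi>'\<in>Rep. (\<forall>y\<in>L. norm (\<pi> y - \<pi>' y) \<le> \<delta>) \<longrightarrow>
    (\<forall>x\<in>K. norm (\<pi> (\<alpha> x) - \<pi>' (\<alpha> x)) \<le> \<epsilon>)"
proof -
  have "K \<subseteq> (\<Union>k\<in>K. ball k (\<epsilon> / 4))" using e by auto
  then obtain N where N: "finite N" "K \<subseteq> (\<Union>k\<in>N. ball k (\<epsilon> / 4))"
    by (rule compactE_image[OF K open_ball])
  define good where "good k \<delta> \<longleftrightarrow> \<delta> > 0 \<and> (\<forall>\<pi>\<in>Rep. \<forall>\<pi>'\<in>Rep.
    (\<forall>y\<in>L. norm (\<pi> y - \<pi>' y) \<le> \<delta>) \<longrightarrow> norm (\<pi> (\<alpha> k) - \<pi>' (\<alpha> k)) \<le> \<epsilon> / 2)" for k \<delta>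
  have "\<exists>\<delta>. good k \<delta>" for k
    unfolding good_def by (rule oscillation_small[OF L half_gt_zero[OF e]])
  then obtain \<delta> where good: "\<And>k. good k (\<delta> k)" by metis
  have \<delta>: "\<delta> k > 0" for k using good[of k] by (simp add: good_def)
  \<comment> \<open>The extra entry \<open>1\<close> gives a positive minimum also when the net is empty.\<close>
  define d where "d = Min (insert 1 (\<delta> ` N))"
  have d: "d > 0" using N(1) \<delta> by (simp add: d_def)
  have d_le: "d \<le> \<delta> k" if "k \<in> N" for k using N(1) that by (simp add: d_def)
  have "norm (\<pi> (\<alpha> x) - \<pi>' (\<alpha> x)) \<le> \<epsilon>"
    if R: "\<pi> \<in> Rep" "\<pi>' \<in> Rep" and y: "\<forall>y\<in>L. norm (\<pi> y - \<pi>' y) \<le> d" and x: "x \<in> K" for \<pi> \<pi>' x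
  proof -
    obtain k where k: "k \<in> N" "dist k x < \<epsilon> / 4" using N(2) x by auto
    have "norm (\<pi> (\<alpha> k) - \<pi>' (\<alpha> k)) \<le> \<epsilon> / 2"
    proof -
      have "\<forall>y\<in>L. norm (\<pi> y - \<pi>' y) \<le> \<delta> k"
        using y d_le[OF k(1)] by (auto intro: order_trans)
      with good[of k] R show ?thesis unfolding good_def by simp
    qed
    then show ?thesis
      using Rep_diff_Lipschitz[OF Rep_comp[OF \<alpha> R(1)] Rep_comp[OF \<alpha> R(2)], of x k] k(2)
      by (simp add: dist_norm norm_minus_commute)
  qed
  with d show ?thesis by blast
qed

lemma pullback_modulus:
  fixes K :: "'a::unital_cstar_algebra set" and L :: "'b::unital_cstar_algebra set"
  assumes \<alpha>: "unital_star_hom \<alpha>" and K: "compact K" and L: "generates L"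
  obtains \<omega> where "\<omega> \<in> Omega"
    "\<And>\<pi> \<pi>' t x. \<pi> \<in> Rep \<Longrightarrow> \<pi>' \<in> Rep \<Longrightarrow> 0 \<le> t \<Longrightarrow> \<forall>y\<in>L. norm (\<pi> y - \<pi>' y) \<le> t \<Longrightarrow> x \<in> K \<Longrightarrow>
      norm (\<pi> (\<alpha> x) - \<pi>' (\<alpha> x)) \<le> \<omega> t"
proof -
  define D where "D = {(t, norm (\<pi> (\<alpha> x) - \<pi>' (\<alpha> x))) |t \<pi> \<pi>' x. 0 \<le> t \<and> \<pi> \<in> Rep \<and> \<pi>' \<in> Rep \<and>
    (\<forall>y\<in>L. norm (\<pi> y - \<pi>' y) \<le> t) \<and> x \<in> K}"
  obtain B where B: "B > 0" "\<And>x. x \<in> K \<Longrightarrow> norm x \<le> B"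
    using compact_imp_bounded[OF K] by (meson bounded_pos)
  have bound: "norm (\<pi> (\<alpha> x) - \<pi>' (\<alpha> x)) \<le> 2 * B" if "\<pi> \<in> Rep" "\<pi>' \<in> Rep" "x \<in> K" for \<pi> \<pi>' x
    using Rep_diff_bound[OF Rep_comp[OF \<alpha> that(1)] Rep_comp[OF \<alpha> that(2)], of x] B(2)[OF that(3)]
    by simp
  have "\<exists>\<delta>>0. \<forall>(s, r)\<in>D. s \<le> \<delta> \<longrightarrow> r \<le> \<epsilon>" if \<epsilon>: "\<epsilon> > 0" for \<epsilon>
  proof -
    obtain \<delta> where \<delta>: "\<delta> > 0" "\<And>\<pi> \<pi>' x. \<pi> \<in> Rep \<Longrightarrow> \<pi>' \<in> Rep \<Longrightarrow>
        \<forall>y\<in>L. norm (\<pi> y - \<pi>' y) \<le> \<delta> \<Longrightarrow> x \<in> K \<Longrightarrow> norm (\<pi> (\<alpha> x) - \<pi>' (\<alpha> x)) \<le> \<epsilon>"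
      using pullback_small[OF \<alpha> K L \<epsilon>] by blast
    then have "\<forall>(s, r)\<in>D. s \<le> \<delta> \<longrightarrow> r \<le> \<epsilon>"
      unfolding D_def by (auto intro!: \<delta>(2) intro: order_trans)
    with \<delta>(1) show ?thesis by blast
  qed
  then obtain \<omega> where \<omega>: "\<omega> \<in> Omega" "\<And>s r. (s, r) \<in> D \<Longrightarrow> r \<le> \<omega> s"
    by (rule Omega_majorant[of D "2 * B", rotated 2]) (use B(1) bound in \<open>auto simp: D_def\<close>)
  show thesis
  proof (rule that[OF \<omega>(1)])
    show "norm (\<pi> (\<alpha> x) - \<pi>' (\<alpha> x)) \<le> \<omega> t"
      if "\<pi> \<in> Rep" "\<pi>' \<in> Rep" "0 \<le> t" "\<forall>y\<in>L. norm (\<pi> y - \<pi>' y) \<le> t" "x \<in> K" for \<pi> \<pi>' t x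
      by (rule \<omega>(2)) (use that in \<open>unfold D_def, blast\<close>)
  qed
qed


section \<open>Uniform continuity of homomorphisms\<close>

theorem theorem6p3:
  fixes K :: "'a::unital_cstar_algebra set"
    and L :: "'b::unital_cstar_algebra set"
    and \<alpha> :: "'a \<Rightarrow> 'b"
  assumes "separable_space (euclidean :: 'a topology)"
    and "separable_space (euclidean :: 'b topology)"
    and "compact K" and "generates K"
    and "compact L" and "generates L"
    and "unital_star_hom \<alpha>"
  shows "\<exists>\<omega>\<in>Omega. \<forall>a. \<forall>t\<ge>0. modulus L (\<alpha> a) t \<le> modulus K a (\<omega> t)"
proof -
  obtain \<omega> where \<omega>: "\<omega> \<in> Omega"
    "\<And>\<pi> \<pi>' t x. \<pi> \<in> Rep \<Longrightarrow> \<pi>' \<in> Rep \<Longrightarrow> 0 \<le> t \<Longrightarrow> \<forall>y\<in>L. norm (\<pi> y - \<pi>' y) \<le> t \<Longrightarrow> x \<in> K \<Longrightarrow>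
      norm (\<pi> (\<alpha> x) - \<pi>' (\<alpha> x)) \<le> \<omega> t"
    using pullback_modulus[OF assms(7,3,6)] by blast
  have \<omega>_nonneg: "0 \<le> \<omega> t" if "0 \<le> t" for t
    using \<omega>(1) that by (simp add: Omega_def)
  have "modulus L (\<alpha> a) t \<le> modulus K a (\<omega> t)" if t: "0 \<le> t" for a t
    unfolding modulus_def[of K]
  proof (rule cInf_greatest)
    \<comment> \<open>The infimum of the empty set of reals is an arbitrary value, so a majorant has to exist.\<close>
    obtain \<omega>' where "\<omega>' \<in> Omega" "\<And>s. 0 \<le> s \<Longrightarrow> oscillation K a s \<le> ennreal (\<omega>' s)"
      using oscillation_majorant[OF assms(4), of a] by blast
    then have "\<omega>' (\<omega> t) \<in> {\<omega>' (\<omega> t) |\<omega>'. \<omega>' \<in> Omega \<and>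
        (\<forall>s\<ge>0. oscillation K a s \<le> ennreal (\<omega>' s))}"
      by (intro CollectI exI[of _ \<omega>']) simp
    then show "{\<omega>' (\<omega> t) |\<omega>'. \<omega>' \<in> Omega \<and> (\<forall>s\<ge>0. oscillation K a s \<le> ennreal (\<omega>' s))} \<noteq> {}"
      by (metis empty_iff)
  next
    fix c
    assume "c \<in> {\<omega>' (\<omega> t) |\<omega>'. \<omega>' \<in> Omega \<and> (\<forall>s\<ge>0. oscillation K a s \<le> ennreal (\<omega>' s))}"
    then obtain \<omega>' where c: "c = \<omega>' (\<omega> t)" and \<omega>': "\<omega>' \<in> Omega"
      and maj: "\<And>s. 0 \<le> s \<Longrightarrow> oscillation K a s \<le> ennreal (\<omega>' s)" by blast
    have "oscillation L (\<alpha> a) s \<le> ennreal (\<omega>' (\<omega> s))" if s: "0 \<le> s" for s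
    proof -
      have pos: "0 \<le> \<omega>' (\<omega> s)" using \<omega>' \<omega>_nonneg[OF s] by (simp add: Omega_def)
      show ?thesis
        unfolding oscillation_le_iff[OF pos s]
      proof (intro ballI impI)
        fix \<pi> \<pi>' :: "'b \<Rightarrow> (ell2 \<Rightarrow>\<^sub>L ell2)"
        assume R: "\<pi> \<in> Rep" "\<pi>' \<in> Rep" and y: "\<forall>y\<in>L. norm (\<pi> y - \<pi>' y) \<le> s"
        have "\<forall>x\<in>K. norm (\<pi> (\<alpha> x) - \<pi>' (\<alpha> x)) \<le> \<omega> s"
          using \<omega>(2)[OF R s y] by simp
        then show "norm (\<pi> (\<alpha> a) - \<pi>' (\<alpha> a)) \<le> \<omega>' (\<omega> s)"
          using maj[OF \<omega>_nonneg[OF s], unfolded oscillation_le_iff[OF pos \<omega>_nonneg[OF s]],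
              rule_format, OF Rep_comp[OF assms(7) R(1)] Rep_comp[OF assms(7) R(2)]]
          by simp
      qed
    qed
    with Omega_comp[OF \<omega>' \<omega>(1)]
    have "c \<in> {\<omega> t |\<omega>. \<omega> \<in> Omega \<and> (\<forall>s\<ge>0. oscillation L (\<alpha> a) s \<le> ennreal (\<omega> s))}"
      unfolding c by (intro CollectI exI[of _ "\<lambda>t. \<omega>' (\<omega> t)"]) simp
    moreover have "bdd_below {\<omega> t |\<omega>. \<omega> \<in> Omega \<and> (\<forall>s\<ge>0. oscillation L (\<alpha> a) s \<le> ennreal (\<omega> s))}"
      using t by (intro bdd_belowI[where m = 0]) (auto simp: Omega_def)
    ultimately show "modulus L (\<alpha> a) t \<le> c"
      unfolding modulus_def by (rule cInf_lower)
  qed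
  with \<omega>(1) show ?thesis by blast
qed

end
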